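(* Let $q$ and $q+1$ both be prime powers, let $X=\mathbb{F}_{q+1}\times\mathbb{F}_q\times\mathbb{F}_q$ with its additive group structure, and consider the commutative association scheme on $X$ with adjacency matrices $A_0=I_{(q+1)q^2}$, $A_1=I_{q+1}\otimes I_q\otimes(J_q-I_q)$, $A_2=I_{q+1}\otimes(J_q-I_q)\otimes J_q$, $A_3=(J_{q+1}-I_{q+1})\otimes I_{q^2}$, $A_4=(J_{q+1}-I_{q+1})\otimes I_q\otimes(J_q-I_q)$, $A_{5,\beta}=N_\beta-A_3$ ($\beta\in\mathbb{F}_{q+1}^*$), with $N_\beta$ as in the context. Then this scheme is a translation association scheme: for each of its relations $R$ (the set of pairs $(u,v)\in X\times X$ where the corresponding adjacency matrix has entry $1$) and all $u,v,z\in X$, $(u,v)\in R$ implies $(u+z,v+z)\in R$.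
   Context: $I_n,J_n$ are the identity and all-ones matrices of order $n$, $\mathbb{F}_r^*=\mathbb{F}_r\setminus\{0\}$, $\otimes$ is the Kronecker product. Let $x$ be a new symbol and fix a bijection $\varphi:\mathbb{F}_{q+1}\to\mathbb{F}_q\cup\{x\}$ with $\varphi(0)=x$. Matrices of order $(q+1)q^2$ have rows and columns indexed by $X$ in lexicographic order (compatible with Kronecker products). For $\beta\in\mathbb{F}_{q+1}^*$, $N_\beta$ is the $(0,1)$-matrix whose $((b,a_1,a_2),(b',a_1',a_2'))$-entry is $1$ if $c=\varphi(\beta(b'-b))$ lies in $\mathbb{F}_q$ and $a_2'-a_2=c(a_1'-a_1)$, and $0$ otherwise. These matrices form a commutative association scheme with $q+4$ classes. *)

theory Defs
  imports "HOL-Analysis.Analysis" "HOL-Number_Theory.Prime_Powers"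
begin

text \<open>
  A matrix whose rows and columns are indexed by a finite type \<open>'x\<close> is an element of
  \<open>real ^ 'x ^ 'x\<close>, with \<open>M $ u $ v\<close> the entry in row \<open>u\<close> and column \<open>v\<close>; identity
  matrices are \<open>mat 1\<close>.  The order of a matrix is the cardinality of its index type, and
  matrices indexed by a product type need no choice of an ordering of the index set.
\<close>

definition all_ones :: "real ^ 'x ^ 'x"
  where "all_ones = (\<chi> u v. 1)"

definition kronecker ::
    "real ^ 'm ^ 'm \<Rightarrow> real ^ 'n ^ 'n \<Rightarrow> real ^ ('m \<times> 'n) ^ ('m \<times> 'n)"
    (infixr "\<otimes>\<^sub>K" 70)
  where "A \<otimes>\<^sub>K B = (\<chi> u v. A $ fst u $ fst v * B $ snd u $ snd v)"

definition matrix_relation :: "real ^ 'x ^ 'x \<Rightarrow> ('x \<times> 'x) set"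
  where "matrix_relation M = {(u, v). M $ u $ v = 1}"

text \<open>
  A commutative association scheme with \<open>d\<close> classes on the finite type \<open>'x\<close>, given by its
  adjacency matrices.  The \<open>d + 1\<close> matrices \<open>A i\<close> are indexed by an arbitrary finite set \<open>I\<close>
  instead of \<open>{0..d}\<close>, and \<open>i\<^sub>0\<close> is the index of the identity relation.
\<close>

definition commutative_association_scheme ::
    "nat \<Rightarrow> 'i set \<Rightarrow> 'i \<Rightarrow> ('i \<Rightarrow> real ^ 'x ^ 'x) \<Rightarrow> bool"
  where "commutative_association_scheme d I i\<^sub>0 A \<longleftrightarrow>
    d \<ge> 1 \<and> finite I \<and> card I = d + 1 \<and> i\<^sub>0 \<in> I \<and>
    (\<forall>i\<in>I. \<forall>u v. A i $ u $ v \<in> {0, 1}) \<and>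
    (\<forall>i\<in>I. matrix_relation (A i) \<noteq> {}) \<and>
    A i\<^sub>0 = mat 1 \<and>
    (\<Sum>i\<in>I. A i) = all_ones \<and>
    (\<forall>i\<in>I. \<exists>j\<in>I. transpose (A i) = A j) \<and>
    (\<forall>i\<in>I. \<forall>j\<in>I. \<exists>p :: 'i \<Rightarrow> nat. A i ** A j = (\<Sum>k\<in>I. real (p k) *\<^sub>R A k)) \<and>
    (\<forall>i\<in>I. \<forall>j\<in>I. A i ** A j = A j ** A i)"

definition translation_association_scheme ::
    "nat \<Rightarrow> 'i set \<Rightarrow> 'i \<Rightarrow>
     ('i \<Rightarrow> real ^ ('x :: {finite, ab_group_add}) ^ ('x :: {finite, ab_group_add})) \<Rightarrow> bool"
  where "translation_association_scheme d I i\<^sub>0 A \<longleftrightarrow>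
    commutative_association_scheme d I i\<^sub>0 A \<and>
    (\<forall>i\<in>I. \<forall>u v z. (u, v) \<in> matrix_relation (A i) \<longrightarrow>
       (u + z, v + z) \<in> matrix_relation (A i))"

text \<open>
  Below, \<open>'k\<close> and \<open>'f\<close> are the fields of orders \<open>q + 1\<close> and \<open>q\<close>; the set obtained from \<open>'f\<close>
  by adding the new symbol \<open>x\<close> is \<open>'f option\<close>, with \<open>None\<close> for \<open>x\<close>.  The additive group
  structure on \<open>'k \<times> 'f \<times> 'f\<close> is the componentwise one of the library.
\<close>

definition N_matrix ::
    "('k :: {finite, field} \<Rightarrow> ('f :: {finite, field}) option) \<Rightarrow> 'k \<Rightarrow>
     real ^ ('k \<times> 'f \<times> 'f) ^ ('k \<times> 'f \<times> 'f)"
  where "N_matrix \<phi> \<beta> = (\<chi> u v. case (u, v) of ((b, a1, a2), (b', a1', a2')) \<Rightarrow>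
    if \<exists>c. \<phi> (\<beta> * (b' - b)) = Some c \<and> a2' - a2 = c * (a1' - a1) then 1 else 0)"

datatype 'k scheme_index = Ix0 | Ix1 | Ix2 | Ix3 | Ix4 | Ix5 'k

definition scheme_indices :: "('k :: zero) scheme_index set"
  where "scheme_indices = {Ix0, Ix1, Ix2, Ix3, Ix4} \<union> Ix5 ` {\<beta>. \<beta> \<noteq> 0}"

primrec adjacency ::
    "('k :: {finite, field} \<Rightarrow> ('f :: {finite, field}) option) \<Rightarrow> 'k scheme_index \<Rightarrow>
     real ^ ('k \<times> 'f \<times> 'f) ^ ('k \<times> 'f \<times> 'f)"
  where
    "adjacency \<phi> Ix0 = mat 1"
  | "adjacency \<phi> Ix1 = mat 1 \<otimes>\<^sub>K mat 1 \<otimes>\<^sub>K (all_ones - mat 1)"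
  | "adjacency \<phi> Ix2 = mat 1 \<otimes>\<^sub>K (all_ones - mat 1) \<otimes>\<^sub>K all_ones"
  | "adjacency \<phi> Ix3 = (all_ones - mat 1) \<otimes>\<^sub>K mat 1"
  | "adjacency \<phi> Ix4 = (all_ones - mat 1) \<otimes>\<^sub>K mat 1 \<otimes>\<^sub>K (all_ones - mat 1)"
  | "adjacency \<phi> (Ix5 \<beta>) = N_matrix \<phi> \<beta> - (all_ones - mat 1) \<otimes>\<^sub>K mat 1"

end

theory Submission
  imports Defs
begin

text \<open>
  Every adjacency matrix is a Cayley matrix on \<open>K \<times> F \<times> F\<close>: its entry at \<open>(u, v)\<close> depends only
  on the class of \<open>v - u\<close>.  Thus translation invariance and commutativity are automatic, and what
  has to be shown is that the functions constant on classes are closed under convolution.  The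
  indicators of the classes \<open>0\<close> to \<open>4\<close> are combinations of indicators of subgroups, and summation
  over the cosets of these subgroups visibly preserves functions constant on classes.  The only
  remaining products are \<open>N\<^sub>\<beta> * N\<^sub>\<gamma>\<close>.  Here \<open>N\<^sub>\<beta>\<close> is the union over \<open>b \<noteq> 0\<close> of the lines of slope
  \<open>\<phi> (\<beta> b)\<close> through the origin of \<open>{b} \<times> F\<^sup>2\<close>; two lines of different slopes convolve to the constant
  \<open>1\<close>, a line with itself to \<open>q\<close> times the line, and the slopes \<open>\<phi> (\<beta> b)\<close> and \<open>\<phi> (\<gamma> (t - b))\<close>
  coincide iff \<open>(\<beta> + \<gamma>) b = \<gamma> t\<close>.
\<close>

section \<open>Translation schemes from partitions of an abelian group\<close>

definition conv :: "('x :: {finite, ab_group_add} \<Rightarrow> real) \<Rightarrow> ('x \<Rightarrow> real) \<Rightarrow> 'x \<Rightarrow> real"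
  where "conv f g x = (\<Sum>y\<in>UNIV. f (x - y) * g y)"

definition ind :: "('x \<Rightarrow> 'i) \<Rightarrow> 'i \<Rightarrow> 'x \<Rightarrow> real"
  where "ind cl i x = of_bool (cl x = i)"

lemma conv_commute: "conv f g = conv g f"
proof
  fix x
  show "conv f g x = conv g f x"
    unfolding conv_def
    by (rule sum.reindex_bij_witness[of _ "\<lambda>y. x - y" "\<lambda>y. x - y"]) auto
qed

lemma conv_diff_left: "conv (\<lambda>x. f x - g x) h = (\<lambda>x. conv f h x - conv g h x)"
  by (auto simp: conv_def sum_subtractf algebra_simps)

lemma conv_diff_right: "conv h (\<lambda>x. f x - g x) = (\<lambda>x. conv h f x - conv h g x)"
  using conv_diff_left conv_commute by metis

lemma cayley_matrix_mult:
  "((\<chi> u v. f (v - u)) ** (\<chi> u v. g (v - u))) $ u $ v = conv f g (v - u)"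
proof -
  have "(\<Sum>w\<in>UNIV. f (w - u) * g (v - w)) = (\<Sum>y\<in>UNIV. f (v - u - y) * g y)"
    by (rule sum.reindex_bij_witness[of _ "\<lambda>y. v - y" "\<lambda>w. v - w"]) (auto simp: algebra_simps)
  then show ?thesis by (simp add: matrix_matrix_mult_def conv_def)
qed

text \<open>Guarantees that the structure constants of the scheme are natural numbers.\<close>

lemma conv_ind_eq_card:
  "conv (ind cl i) (ind cl j) x = real (card {y. cl (x - y) = i \<and> cl y = j})"
  by (simp add: conv_def ind_def flip: of_bool_conj)

text \<open>The hypotheses on \<open>cl\<close> say that its fibres form a Schur ring: zero is a
  fibre of its own, negation permutes the fibres, and convolution products of their indicators are
  constant on fibres.\<close>

lemma translation_association_schemeI:
  fixes cl :: "'x :: {finite, ab_group_add} \<Rightarrow> 'i"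
  assumes A: "\<And>i u v. i \<in> I \<Longrightarrow> A i $ u $ v = ind cl i (v - u)"
    and I: "range cl = I" "card I = d + 1" "d \<ge> 1"
    and zero: "\<And>x. cl x = i\<^sub>0 \<longleftrightarrow> x = 0"
    and uminus: "\<And>x. cl (- x) = \<sigma> (cl x)"
    and conv: "\<And>i j x y. i \<in> I \<Longrightarrow> j \<in> I \<Longrightarrow> cl x = cl y \<Longrightarrow>
      conv (ind cl i) (ind cl j) x = conv (ind cl i) (ind cl j) y"
  shows "translation_association_scheme d I i\<^sub>0 A"
proof -
  have A': "A i = (\<chi> u v. ind cl i (v - u))" if "i \<in> I" for i
    using A[OF that] by (simp add: vec_eq_iff)
  have fin: "finite I" using I by auto
  have "i\<^sub>0 = cl 0" using zero by metis
  then have i0: "i\<^sub>0 \<in> I" using I by auto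
  have mult: "(A i ** A j) $ u $ v = conv (ind cl i) (ind cl j) (v - u)"
    if "i \<in> I" "j \<in> I" for i j u v
    using that by (simp add: A' cayley_matrix_mult)
  have nonempty: "matrix_relation (A i) \<noteq> {}" if i: "i \<in> I" for i
  proof -
    obtain x where "cl x = i" using i I by auto
    then have "(0, x) \<in> matrix_relation (A i)" by (simp add: matrix_relation_def A i ind_def)
    then show ?thesis by auto
  qed
  have total: "(\<Sum>i\<in>I. A i) = all_ones"
  proof -
    have "(\<Sum>i\<in>I. A i $ u $ v) = 1" for u v
    proof -
      have "(\<Sum>i\<in>I. A i $ u $ v) = (\<Sum>i\<in>I. if cl (v - u) = i then 1 else 0)"
        by (rule sum.cong) (auto simp: A ind_def)
      also have "\<dots> = 1" using fin I by auto
      finally show ?thesis .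
    qed
    then show ?thesis by (simp add: vec_eq_iff all_ones_def)
  qed
  have transp: "\<exists>j\<in>I. transpose (A i) = A j" if i: "i \<in> I" for i
  proof -
    obtain z where z: "cl z = i" using i I by auto
    have j: "\<sigma> i \<in> I" using z uminus[of z] I(1) by (metis rangeI)
    \<comment> \<open>Negating \<open>z\<close> twice gives \<sigma> (\<sigma> i) = i, which yields
      the direction from right to left.\<close>
    have "cl (u - v) = i \<longleftrightarrow> cl (v - u) = \<sigma> i" for u v
      using uminus[of "u - v"] uminus[of "v - u"] uminus[of "- z"] uminus[of z] z by auto
    then have "transpose (A i) = A (\<sigma> i)"
      by (simp add: vec_eq_iff transpose_def A i j ind_def)
    with j show ?thesis by blast
  qed
  have closed: "\<exists>p :: 'i \<Rightarrow> nat. A i ** A j = (\<Sum>k\<in>I. real (p k) *\<^sub>R A k)"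
    if ij: "i \<in> I" "j \<in> I" for i j
  proof -
    \<comment> \<open>An intersection number, counted at one representative of class
      \<open>k\<close>; by \<open>conv\<close> every other representative gives the same
      count.\<close>
    define p where "p k = card {y. cl (inv cl k - y) = i \<and> cl y = j}" for k
    have p: "real (p (cl x)) = conv (ind cl i) (ind cl j) x" for x
      using conv[OF ij, of "inv cl (cl x)" x] by (simp add: p_def conv_ind_eq_card f_inv_into_f)
    have "(\<Sum>k\<in>I. real (p k) * A k $ u $ v) = (A i ** A j) $ u $ v" for u v
    proof -
      have "(\<Sum>k\<in>I. real (p k) * A k $ u $ v) =
          (\<Sum>k\<in>I. if cl (v - u) = k then real (p k) else 0)"
        by (rule sum.cong) (auto simp: A ind_def)
      also have "\<dots> = real (p (cl (v - u)))" using fin I by auto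
      also have "\<dots> = (A i ** A j) $ u $ v" by (simp add: p mult ij)
      finally show ?thesis .
    qed
    then have "A i ** A j = (\<Sum>k\<in>I. real (p k) *\<^sub>R A k)" by (simp add: vec_eq_iff)
    then show ?thesis by blast
  qed
  have comm: "A i ** A j = A j ** A i" if "i \<in> I" "j \<in> I" for i j
    using that conv_commute[of "ind cl i" "ind cl j"] by (simp add: vec_eq_iff mult)
  have "A i\<^sub>0 = mat 1" by (auto simp: vec_eq_iff mat_def A i0 ind_def zero)
  moreover have "A i $ u $ v \<in> {0, 1}" if "i \<in> I" for i u v
    using that by (simp add: A ind_def)
  ultimately have "commutative_association_scheme d I i\<^sub>0 A"
    unfolding commutative_association_scheme_def
    using I fin i0 nonempty total transp closed comm by (intro conjI ballI allI) simp_all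
  moreover have "(u + z, v + z) \<in> matrix_relation (A i)"
    if "i \<in> I" "(u, v) \<in> matrix_relation (A i)" for i u v z
    using that by (simp add: matrix_relation_def A)
  ultimately show ?thesis unfolding translation_association_scheme_def by blast
qed

section \<open>The class of a group element\<close>

lemma sum_UNIV_prod: "(\<Sum>x\<in>UNIV. f x) = (\<Sum>a\<in>UNIV. \<Sum>b\<in>UNIV. f (a, b))"
  for f :: "'a :: finite \<times> 'b :: finite \<Rightarrow> real"
  by (simp add: sum.cartesian_product flip: UNIV_Times_UNIV)

locale slope_labelling =
  fixes \<phi> :: "'k :: {finite, field} \<Rightarrow> ('f :: {finite, field}) option"
  assumes bij: "bij \<phi>" and zero: "\<phi> 0 = None"
begin

text \<open>As \<open>\<phi> 0 = None\<close>, this is a bijection from \<open>'f\<close> onto the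
  nonzero elements of \<open>'k\<close>; it turns slope conditions into equations in
  \<open>'k\<close>.\<close>

definition \<psi> :: "'f \<Rightarrow> 'k" where "\<psi> c = inv \<phi> (Some c)"

lemma phi_eq_Some_iff: "\<phi> k = Some c \<longleftrightarrow> k = \<psi> c"
  using bij unfolding \<psi>_def by (metis bij_inv_eq_iff)

lemma psi_nonzero [simp]: "\<psi> c \<noteq> 0"
  using phi_eq_Some_iff[of 0 c] zero by auto

lemma psi_eq_iff [simp]: "\<psi> c = \<psi> d \<longleftrightarrow> c = d"
  using phi_eq_Some_iff by (metis option.inject)

lemma psi_surj: "k \<noteq> 0 \<Longrightarrow> \<exists>c. k = \<psi> c"
  using zero bij phi_eq_Some_iff by (metis bij_pointE not_None_eq)

text \<open>In the last case \<open>\<psi> (a' / a) / b\<close> is the only \<beta> for which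
  \<open>\<phi> (\<beta> * b)\<close> is the slope of the line through the origin and (a, a'). For b
  nonzero, the origin of the fibre, which lies on all lines, and the rest of the vertical line get
  \<open>Ix3\<close> and \<open>Ix4\<close>.\<close>

fun cl :: "'k \<times> 'f \<times> 'f \<Rightarrow> 'k scheme_index" where
  "cl (b, a, a') = (if b = 0 then (if a = 0 then (if a' = 0 then Ix0 else Ix1) else Ix2)
     else if a = 0 then (if a' = 0 then Ix3 else Ix4) else Ix5 (\<psi> (a' / a) / b))"

lemma range_cl: "range cl = scheme_indices"
proof
  show "range cl \<subseteq> scheme_indices" by (auto simp: scheme_indices_def split: if_splits)
next
  have "Ix0 = cl (0, 0, 0)" "Ix1 = cl (0, 0, 1)" "Ix2 = cl (0, 1, 0)"
    "Ix3 = cl (1, 0, 0)" "Ix4 = cl (1, 0, 1)"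
    by simp_all
  moreover have "Ix5 \<beta> = cl (\<psi> 0 / \<beta>, 1, 0)" if "\<beta> \<noteq> 0" for \<beta>
    using that by simp
  ultimately show "scheme_indices \<subseteq> range cl" unfolding scheme_indices_def by blast
qed

lemma cl_eq_Ix0_iff: "cl x = Ix0 \<longleftrightarrow> x = 0"
  by (cases x) (auto simp: zero_prod_def)

text \<open>Negation preserves the slope a' / a and changes the sign of b.\<close>

lemma cl_uminus: "cl (- x) = (case cl x of Ix5 \<beta> \<Rightarrow> Ix5 (- \<beta>) | i \<Rightarrow> i)"
  by (cases x) auto

text \<open>This is \<open>N_matrix\<close> as a function of the difference of its indices. Keeping
  the points (b, 0, 0), unlike \<open>Ix5\<close>, makes every fibre over a nonzero b a full line,
  which is what convolves well.\<close>

definition line_ind :: "'k \<Rightarrow> 'k \<times> 'f \<times> 'f \<Rightarrow> real" where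
  "line_ind \<beta> x = of_bool (\<exists>c. \<beta> * fst x = \<psi> c \<and> snd (snd x) = c * fst (snd x))"

lemma line_ind_eq: assumes "\<beta> \<noteq> 0" shows "line_ind \<beta> = (\<lambda>x. ind cl (Ix5 \<beta>) x + ind cl Ix3 x)"
proof
  fix x :: "'k \<times> 'f \<times> 'f"
  obtain b a a' where x: "x = (b, a, a')" by (cases x)
  show "line_ind \<beta> x = ind cl (Ix5 \<beta>) x + ind cl Ix3 x"
  proof (cases "b = 0")
    case True
    then show ?thesis using psi_nonzero by (auto simp: x line_ind_def ind_def)
  next
    case b: False
    then obtain c where c: "\<beta> * b = \<psi> c" using psi_surj[of "\<beta> * b"] assms by auto
    have "(\<psi> (a' / a) / b = \<beta>) \<longleftrightarrow> a' = c * a" if "a \<noteq> 0"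
    proof -
      have "(\<psi> (a' / a) / b = \<beta>) \<longleftrightarrow> \<psi> (a' / a) = \<psi> c" using b by (auto simp: c[symmetric] field_simps)
      then show ?thesis using that by (auto simp: field_simps)
    qed
    then show ?thesis using b by (auto simp: x line_ind_def ind_def c)
  qed
qed

lemma adjacency_entry:
  assumes "i \<in> scheme_indices"
  shows "adjacency \<phi> i $ u $ v = ind cl i (v - u)"
proof -
  obtain b a a' where u: "u = (b, a, a')" by (cases u)
  obtain d e e' where v: "v = (d, e, e')" by (cases v)
  have N: "N_matrix \<phi> \<beta> $ u $ v = line_ind \<beta> (v - u)" for \<beta>
    by (simp add: u v N_matrix_def line_ind_def phi_eq_Some_iff)
  show ?thesis
  proof (cases i)
    case (Ix5 \<beta>)
    then have "\<beta> \<noteq> 0" using assms by (auto simp: scheme_indices_def)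
    then show ?thesis
      by (auto simp: Ix5 N line_ind_eq)
        (auto simp: u v kronecker_def mat_def all_ones_def ind_def)
  qed (auto simp: u v kronecker_def mat_def all_ones_def ind_def)
qed

section \<open>Functions constant on classes\<close>

definition class_fun :: "('k \<times> 'f \<times> 'f \<Rightarrow> real) \<Rightarrow> bool" where
  "class_fun f \<longleftrightarrow> (\<exists>F. \<forall>x. f x = F (cl x))"

lemma class_funI:
  assumes "\<And>a'. a' \<noteq> 0 \<Longrightarrow> f (0, 0, a') = r1"
    and "\<And>a a'. a \<noteq> 0 \<Longrightarrow> f (0, a, a') = r2"
    and "\<And>b. b \<noteq> 0 \<Longrightarrow> f (b, 0, 0) = r3"
    and "\<And>b a'. b \<noteq> 0 \<Longrightarrow> a' \<noteq> 0 \<Longrightarrow> f (b, 0, a') = r4"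
    and "\<And>b a a'. b \<noteq> 0 \<Longrightarrow> a \<noteq> 0 \<Longrightarrow> f (b, a, a') = r5 (\<psi> (a' / a) / b)"
  shows "class_fun f"
proof -
  \<comment> \<open>Class \<open>Ix0\<close> is a single point, so its value is read off from
    f.\<close>
  define F where "F i = (case i of Ix0 \<Rightarrow> f (0, 0, 0) | Ix1 \<Rightarrow> r1 | Ix2 \<Rightarrow> r2 | Ix3 \<Rightarrow> r3
    | Ix4 \<Rightarrow> r4 | Ix5 \<beta> \<Rightarrow> r5 \<beta>)" for i
  have "f x = F (cl x)" for x
    by (cases x) (auto simp: F_def assms)
  then show ?thesis unfolding class_fun_def by blast
qed

lemma class_funE:
  assumes "class_fun f"
  obtains F where "f = (\<lambda>x. F (cl x))"
  using assms unfolding class_fun_def by blast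

lemma class_fun_const: "class_fun (\<lambda>x. r)"
  unfolding class_fun_def by (rule exI[of _ "\<lambda>_. r"]) simp

lemma class_fun_ind: "class_fun (ind cl i)"
  unfolding class_fun_def ind_def by (rule exI[of _ "\<lambda>k. of_bool (k = i)"]) simp

lemma class_fun_compose2: "class_fun f \<Longrightarrow> class_fun g \<Longrightarrow> class_fun (\<lambda>x. h (f x) (g x))"
proof -
  assume "class_fun f" "class_fun g"
  then obtain F G where "f = (\<lambda>x. F (cl x))" "g = (\<lambda>x. G (cl x))" by (metis class_funE)
  then show ?thesis unfolding class_fun_def by (intro exI[of _ "\<lambda>i. h (F i) (G i)"]) simp
qed

lemmas class_fun_add = class_fun_compose2[where h = "(+)"]
lemmas class_fun_diff = class_fun_compose2[where h = "(-)"]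
lemmas class_fun_mult = class_fun_compose2[where h = "(*)"]

lemma class_fun_line_ind: "\<beta> \<noteq> 0 \<Longrightarrow> class_fun (line_ind \<beta>)"
  by (simp add: line_ind_eq class_fun_add class_fun_ind)

text \<open>The classes \<open>Ix0\<close>, \<open>Ix1\<close>, \<open>Ix2\<close> fill exactly the
  subgroup b = 0. This serves the products of line indicators, whose formula depends on whether the
  first coordinate vanishes.\<close>

lemma class_fun_if:
  assumes "class_fun f" "class_fun g"
  shows "class_fun (\<lambda>x. if fst x = 0 then f x else g x)"
proof -
  obtain F G where FG: "f = (\<lambda>x. F (cl x))" "g = (\<lambda>x. G (cl x))"
    using assms by (metis class_funE)
  have "fst x = 0 \<longleftrightarrow> cl x \<in> {Ix0, Ix1, Ix2}" for x
    by (cases x) auto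
  then show ?thesis
    unfolding class_fun_def FG by (intro exI[of _ "\<lambda>i. if i \<in> {Ix0, Ix1, Ix2} then F i else G i"]) simp
qed

text \<open>For nonzero a and b the slope t / a runs through all of \<open>'f\<close>, so the sum
  meets every class \<open>Ix5 \<beta>\<close> exactly once, whatever the point.\<close>

lemma class_fun_sum_snd:
  assumes "class_fun f"
  shows "class_fun (\<lambda>(b, a, a'). \<Sum>t\<in>UNIV. f (b, a, t))"
proof -
  obtain F where F: "f = (\<lambda>x. F (cl x))" using assms by (rule class_funE)
  have *: "(\<Sum>t\<in>UNIV. F (Ix5 (\<psi> (t / a) / b))) = (\<Sum>\<beta> | \<beta> \<noteq> 0. F (Ix5 \<beta>))"
    if "b \<noteq> 0" "a \<noteq> 0" for a b
  proof -
    have "bij_betw (\<lambda>t. \<psi> (t / a) / b) UNIV {\<beta>. \<beta> \<noteq> 0}"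
    proof (rule bij_betw_imageI)
      show "inj (\<lambda>t. \<psi> (t / a) / b)" using that by (auto simp: inj_on_def)
      have "\<beta> \<in> range (\<lambda>t. \<psi> (t / a) / b)" if \<beta>: "\<beta> \<noteq> 0" for \<beta>
      proof -
        obtain c where "\<beta> * b = \<psi> c" using psi_surj[of "\<beta> * b"] \<beta> \<open>b \<noteq> 0\<close> by auto
        then have "\<beta> = \<psi> (c * a / a) / b" using \<open>b \<noteq> 0\<close> \<open>a \<noteq> 0\<close> by (simp add: field_simps)
        then show ?thesis by blast
      qed
      then show "range (\<lambda>t. \<psi> (t / a) / b) = {\<beta>. \<beta> \<noteq> 0}" using that by auto
    qed
    then show ?thesis by (rule sum.reindex_bij_betw)
  qed
  show ?thesis
    by (rule class_funI[of _ "\<Sum>t\<in>UNIV. F (if t = (0 :: 'f) then Ix0 else Ix1)" "\<Sum>t\<in>(UNIV :: 'f set). F Ix2"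
          "\<Sum>t\<in>UNIV. F (if t = (0 :: 'f) then Ix3 else Ix4)"
          "\<Sum>t\<in>UNIV. F (if t = (0 :: 'f) then Ix3 else Ix4)" "\<lambda>_. \<Sum>\<beta> | \<beta> \<noteq> 0. F (Ix5 \<beta>)"])
      (simp_all add: F *)
qed

text \<open>For nonzero a the term t = 0 lies in \<open>Ix2\<close>, and the other t meet every
  class \<open>Ix5 \<beta>\<close> exactly once, because t \<mapsto> \<psi> c / t permutes the
  nonzero elements.\<close>

lemma class_fun_sum_fst:
  assumes "class_fun f"
  shows "class_fun (\<lambda>(b, x). \<Sum>t\<in>UNIV. f (t, x))"
proof -
  obtain F where F: "f = (\<lambda>x. F (cl x))" using assms by (rule class_funE)
  have *: "(\<Sum>t\<in>UNIV. F (if t = 0 then Ix2 else Ix5 (\<psi> c / t))) = F Ix2 + (\<Sum>\<beta> | \<beta> \<noteq> 0. F (Ix5 \<beta>))"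
    for c
  proof -
    have "(\<Sum>t\<in>UNIV. F (if t = 0 then Ix2 else Ix5 (\<psi> c / t))) =
        F Ix2 + (\<Sum>t | t \<noteq> 0. F (Ix5 (\<psi> c / t)))"
      by (subst sum.remove[of UNIV 0]) (auto intro!: sum.cong)
    also have "(\<Sum>t | t \<noteq> 0. F (Ix5 (\<psi> c / t))) = (\<Sum>\<beta> | \<beta> \<noteq> 0. F (Ix5 \<beta>))"
      by (rule sum.reindex_bij_witness[of _ "\<lambda>t. \<psi> c / t" "\<lambda>t. \<psi> c / t"]) auto
    finally show ?thesis .
  qed
  show ?thesis
    by (rule class_funI[of _ "\<Sum>t\<in>UNIV. F (if t = (0 :: 'k) then Ix1 else Ix4)"
          "F Ix2 + (\<Sum>\<beta> | \<beta> \<noteq> 0. F (Ix5 \<beta>))"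
          "\<Sum>t\<in>UNIV. F (if t = (0 :: 'k) then Ix0 else Ix3)"
          "\<Sum>t\<in>UNIV. F (if t = (0 :: 'k) then Ix1 else Ix4)"
          "\<lambda>_. F Ix2 + (\<Sum>\<beta> | \<beta> \<noteq> 0. F (Ix5 \<beta>))"])
      (simp_all add: F * cong: if_cong)
qed

lemma class_fun_sum_snd2:
  assumes "class_fun f"
  shows "class_fun (\<lambda>(b, x). \<Sum>y\<in>UNIV. f (b, y))"
proof -
  define g where "g = (\<lambda>(b, a, a' :: 'f). \<Sum>t\<in>UNIV. f (b, a, t))"
  obtain G where G: "g = (\<lambda>x. G (cl x))"
    using class_fun_sum_snd[OF assms] unfolding g_def by (rule class_funE)
  have g0: "g (b, a, a') = g (b, a, 0)" for b a a' by (simp add: g_def)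
  have g1: "g (b, a, 0) = G (if a = 0 then Ix3 else Ix5 1)" if b: "b \<noteq> 0" for b a
  proof (cases "a = 0")
    case False
    \<comment> \<open>As \<open>g\<close> ignores its last coordinate, that coordinate may be chosen
      to put the point into class \<open>Ix5 1\<close>; hence the value depends on neither b nor
      a.\<close>
    obtain c where "b = \<psi> c" using psi_surj[OF b] by blast
    then have "cl (b, a, c * a) = Ix5 1" using False by simp
    then show ?thesis using g0[of b a "c * a"] G False by metis
  qed (use b in \<open>simp add: G\<close>)
  have "(\<lambda>(b, x). \<Sum>y\<in>UNIV. f (b, y)) = (\<lambda>(b, x :: 'f \<times> 'f). \<Sum>a\<in>UNIV. g (b, a, 0))"
    by (simp add: sum_UNIV_prod g_def)
  moreover have "class_fun \<dots>"
    by (rule class_funI[of _ "\<Sum>a\<in>UNIV. g (0, a, 0)" "\<Sum>a\<in>UNIV. g (0, a, 0)"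
          "\<Sum>a\<in>UNIV. G (if a = (0 :: 'f) then Ix3 else Ix5 1)"
          "\<Sum>a\<in>UNIV. G (if a = (0 :: 'f) then Ix3 else Ix5 1)"
          "\<lambda>_. \<Sum>a\<in>UNIV. G (if a = (0 :: 'f) then Ix3 else Ix5 1)"])
      (simp_all add: g1)
  ultimately show ?thesis by (simp only:)
qed

section \<open>Closure under convolution\<close>

text \<open>With sides \<open>{0}\<close> and \<open>UNIV\<close> these boxes are subgroups, and
  convolving with one sums over its cosets.\<close>

definition block :: "'k set \<Rightarrow> 'f set \<Rightarrow> 'f set \<Rightarrow> 'k \<times> 'f \<times> 'f \<Rightarrow> real"
  where "block P Q R y = of_bool (y \<in> P \<times> Q \<times> R)"

lemma conv_block:
  "conv f (block P Q R) (b, a, a') = (\<Sum>s\<in>P. \<Sum>t\<in>Q. \<Sum>w\<in>R. f (b - s, a - t, a' - w))"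
proof -
  have "conv f (block P Q R) (b, a, a') = (\<Sum>y\<in>P \<times> Q \<times> R. f ((b, a, a') - y))"
    unfolding conv_def block_def by (rule sum.mono_neutral_cong_right) auto
  also have "\<dots> = (\<Sum>s\<in>P. \<Sum>x\<in>Q \<times> R. f ((b, a, a') - (s, x)))"
    unfolding sum.cartesian_product by (rule sum.cong) auto
  also have "\<dots> = (\<Sum>s\<in>P. \<Sum>t\<in>Q. \<Sum>w\<in>R. f ((b, a, a') - (s, t, w)))"
    unfolding sum.cartesian_product by (rule sum.cong) auto
  finally show ?thesis by simp
qed

lemma sum_diff_UNIV: "(\<Sum>t\<in>UNIV. g (a - t)) = (\<Sum>t\<in>UNIV. g t :: real)"
  for a :: "'a :: {finite, ab_group_add}"
  by (rule sum.reindex_bij_witness[of _ "\<lambda>t. a - t" "\<lambda>t. a - t"]) auto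

lemma class_fun_conv_block:
  assumes f: "class_fun f"
  shows "class_fun (conv f (block {0} {0} {0}))"
    and "class_fun (conv f (block {0} {0} UNIV))"
    and "class_fun (conv f (block {0} UNIV UNIV))"
    and "class_fun (conv f (block UNIV {0} {0}))"
    and "class_fun (conv f (block UNIV {0} UNIV))"
proof -
  have "conv f (block {0} {0} {0}) = f"
    by (auto simp: conv_block)
  with f show "class_fun (conv f (block {0} {0} {0}))" by simp
  have "conv f (block {0} {0} UNIV) = (\<lambda>(b, a, a'). \<Sum>t\<in>UNIV. f (b, a, t))"
    by (auto simp: conv_block sum_diff_UNIV[of "\<lambda>t. f (_, _, t)"])
  with f show "class_fun (conv f (block {0} {0} UNIV))" by (simp add: class_fun_sum_snd)
  have "conv f (block {0} UNIV UNIV) = (\<lambda>(b, x). \<Sum>y\<in>UNIV. f (b, y))"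
    by (auto simp: conv_block sum_UNIV_prod sum_diff_UNIV[of "\<lambda>t. f (_, _, t)"]
        sum_diff_UNIV[of "\<lambda>s. \<Sum>t\<in>UNIV. f (_, s, t)"])
  with f show "class_fun (conv f (block {0} UNIV UNIV))" by (simp add: class_fun_sum_snd2)
  have "conv f (block UNIV {0} {0}) = (\<lambda>(b, x). \<Sum>t\<in>UNIV. f (t, x))"
    by (auto simp: conv_block sum_diff_UNIV[of "\<lambda>t. f (t, _)"])
  with f show "class_fun (conv f (block UNIV {0} {0}))" by (simp add: class_fun_sum_fst)
  \<comment> \<open>The coset sum is taken in two stages, first over the last coordinate and then
    over the first.\<close>
  have "conv f (block UNIV {0} UNIV) =
      (\<lambda>(b, x). \<Sum>s\<in>UNIV. (\<lambda>(b, a, a'). \<Sum>t\<in>UNIV. f (b, a, t)) (s, x))"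
    by (auto simp: conv_block sum_diff_UNIV[of "\<lambda>t. f (_, _, t)"]
        sum_diff_UNIV[of "\<lambda>s. \<Sum>t\<in>UNIV. f (s, _, t)"])
  with f show "class_fun (conv f (block UNIV {0} UNIV))"
    by (simp only: class_fun_sum_fst class_fun_sum_snd)
qed

lemma class_fun_conv_ind:
  assumes f: "class_fun f" and i: "i \<in> {Ix0, Ix1, Ix2, Ix3, Ix4}"
  shows "class_fun (conv f (ind cl i))"
proof -
  have 0: "ind cl Ix0 = block {0} {0} {0}"
    and 1: "ind cl Ix1 = (\<lambda>x. block {0} {0} UNIV x - block {0} {0} {0} x)"
    and 2: "ind cl Ix2 = (\<lambda>x. block {0} UNIV UNIV x - block {0} {0} UNIV x)"
    and 3: "ind cl Ix3 = (\<lambda>x. block UNIV {0} {0} x - block {0} {0} {0} x)"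
    and 4: "ind cl Ix4 = (\<lambda>x. block UNIV {0} UNIV x - block {0} {0} UNIV x - ind cl Ix3 x)"
    by (auto simp: fun_eq_iff ind_def block_def)
  \<comment> \<open>\<open>Ix3\<close> is settled first because the combination for
    \<open>Ix4\<close> contains its indicator.\<close>
  have 3: "class_fun (conv f (ind cl Ix3))"
    unfolding 3 by (intro class_fun_conv_block class_fun_diff f conv_diff_right[THEN ssubst])
  show ?thesis
    using i by (auto simp: 0 1 2 3 4 conv_diff_right intro!: class_fun_conv_block class_fun_diff f)
qed

section \<open>Convolution of two line indicators\<close>

lemma sum_line_mult_line:
  fixes a a' c d :: 'f
  shows "(\<Sum>s\<in>UNIV. \<Sum>w\<in>UNIV. of_bool (a' - w = d * (a - s)) * of_bool (w = c * s)) =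
    (if c = d then real CARD('f) * of_bool (a' = c * a) else 1)"
proof -
  have "(\<Sum>w\<in>UNIV. of_bool (a' - w = d * (a - s)) * of_bool (w = c * s)) =
      (of_bool (a' - c * s = d * (a - s)) :: real)" for s
  proof -
    have "(\<Sum>w\<in>UNIV. of_bool (a' - w = d * (a - s)) * of_bool (w = c * s)) =
        (\<Sum>w\<in>UNIV. if w = c * s then of_bool (a' - c * s = d * (a - s)) else (0 :: real))"
      by (rule sum.cong) auto
    then show ?thesis by simp
  qed
  \<comment> \<open>The condition is linear in s with leading coefficient c - d: it has one solution
    if the slopes differ, and does not involve s if they agree.\<close>
  moreover have "(\<Sum>s\<in>UNIV. of_bool (a' - c * s = d * (a - s))) =
    (if c = d then real CARD('f) * of_bool (a' = c * a) else 1)"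
  proof (cases "c = d")
    case True
    then have "a' - c * s = d * (a - s) \<longleftrightarrow> a' = c * a" for s
      by (auto simp: algebra_simps)
    then show ?thesis using True by simp
  next
    case False
    then have "a' - c * s = d * (a - s) \<longleftrightarrow> s = (a' - d * a) / (c - d)" for s
      by (auto simp: field_simps)
    then show ?thesis using False by (simp add: of_bool_def)
  qed
  ultimately show ?thesis by simp
qed

text \<open>Line indicators vanish on the fibre over 0, which removes b = 0 and b = t. For every
  other b the two fibres are lines, with equal slopes exactly when their arguments under
  \<open>\<phi>\<close> agree.\<close>

lemma conv_line_ind:
  assumes "\<beta> \<noteq> 0" "\<gamma> \<noteq> 0"
  shows "conv (line_ind \<gamma>) (line_ind \<beta>) (t, x) =
    (\<Sum>b\<in>UNIV - {0, t}. if \<beta> * b = \<gamma> * (t - b) then CARD('f) * line_ind \<beta> (b, x) else 1)"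
proof -
  obtain a a' where x: "x = (a, a')" by (cases x)
  let ?S = "\<lambda>b. \<Sum>s\<in>UNIV. \<Sum>w\<in>UNIV. line_ind \<gamma> (t - b, a - s, a' - w) * line_ind \<beta> (b, s, w)"
  have 0: "?S b = 0" if "b \<in> {0, t}" for b
    using that psi_nonzero by (auto simp: line_ind_def intro!: sum.neutral)
  have S: "?S b = (if \<beta> * b = \<gamma> * (t - b) then CARD('f) * line_ind \<beta> (b, x) else 1)"
    if b: "b \<in> UNIV - {0, t}" for b
  proof -
    obtain c where c: "\<beta> * b = \<psi> c" using psi_surj[of "\<beta> * b"] b assms by auto
    obtain d where d: "\<gamma> * (t - b) = \<psi> d" using psi_surj[of "\<gamma> * (t - b)"] b assms by auto
    show ?thesis
      using sum_line_mult_line[of a' d a c] by (simp add: line_ind_def c d x)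
  qed
  have "conv (line_ind \<gamma>) (line_ind \<beta>) (t, x) = (\<Sum>b\<in>UNIV. ?S b)"
    by (simp add: conv_def sum_UNIV_prod x)
  also have "\<dots> = (\<Sum>b\<in>UNIV - {0, t}. ?S b)"
    by (rule sum.mono_neutral_right) (use 0 in auto)
  also have "\<dots> = (\<Sum>b\<in>UNIV - {0, t}. if \<beta> * b = \<gamma> * (t - b) then CARD('f) * line_ind \<beta> (b, x) else 1)"
    by (rule sum.cong) (use S in auto)
  finally show ?thesis .
qed

lemma class_fun_conv_line_ind:
  assumes \<beta>: "\<beta> \<noteq> 0" and \<gamma>: "\<gamma> \<noteq> 0"
  shows "class_fun (conv (line_ind \<gamma>) (line_ind \<beta>))"
proof (cases "\<beta> + \<gamma> = 0")
  case True
  then have \<gamma>_eq: "\<gamma> = - \<beta>" by (simp add: add_eq_0_iff)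
  \<comment> \<open>The slopes agree for all b if t = 0 and for no b otherwise.\<close>
  have eq: "\<beta> * b = \<gamma> * (t - b) \<longleftrightarrow> t = 0" for b t
    using \<beta> by (simp add: \<gamma>_eq algebra_simps)
  let ?f = "\<lambda>(b :: 'k, x). \<Sum>t\<in>UNIV. line_ind \<beta> (t, x)"
  have "conv (line_ind \<gamma>) (line_ind \<beta>) (t, x) =
      (if t = 0 then CARD('f) * ?f (t, x) else CARD('k) - 2)" for t x
  proof (cases "t = 0")
    case True
    \<comment> \<open>The omitted term b = 0 can thus be restored, giving a sum over all of
      \<open>'k\<close>.\<close>
    have "line_ind \<beta> (0, x) = 0" using psi_nonzero by (auto simp: line_ind_def)
    then have "(\<Sum>b\<in>UNIV - {0}. line_ind \<beta> (b, x)) = ?f (t, x)"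
      by (simp add: sum_diff1)
    then show ?thesis
      unfolding conv_line_ind[OF \<beta> \<gamma>] eq using True by (simp flip: sum_distrib_left)
  next
    case False
    then show ?thesis
      using \<beta> \<gamma> by (simp add: conv_line_ind eq card_Diff_subset)
  qed
  then have "conv (line_ind \<gamma>) (line_ind \<beta>) =
      (\<lambda>x. if fst x = 0 then CARD('f) * ?f x else CARD('k) - 2)" by auto
  moreover have "class_fun \<dots>"
    by (intro class_fun_if class_fun_const class_fun_mult class_fun_sum_fst class_fun_line_ind \<beta>)
  ultimately show ?thesis by (simp only:)
next
  case False
  \<comment> \<open>The slopes agree only at b = \<gamma> t / (\<beta> + \<gamma>), where \<beta> b
    = \<delta> t; so the line that appears in the fibre over t is the one labelled \<delta>.\<close>
  define \<delta> where "\<delta> = \<beta> * \<gamma> / (\<beta> + \<gamma>)"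
  have \<delta>: "\<delta> \<noteq> 0" using False \<beta> \<gamma> by (simp add: \<delta>_def)
  have eq: "\<beta> * b = \<gamma> * (t - b) \<longleftrightarrow> b = \<gamma> * t / (\<beta> + \<gamma>)" for b t
    using False by (auto simp: field_simps)
  have "conv (line_ind \<gamma>) (line_ind \<beta>) (t, x) =
      (if t = 0 then CARD('k) - 1 else (real (CARD('k) - 2) - 1) + CARD('f) * line_ind \<delta> (t, x))" for t x
  proof (cases "t = 0")
    case True
    \<comment> \<open>For t = 0 the only coincidence is at b = 0, which is excluded, so every
      summand is 1.\<close>
    then have "conv (line_ind \<gamma>) (line_ind \<beta>) (t, x) = (\<Sum>b\<in>UNIV - {0 :: 'k}. 1)"
      unfolding conv_line_ind[OF \<beta> \<gamma>] eq by (intro sum.cong) auto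
    then show ?thesis using True by (simp add: card_Diff_subset)
  next
    case t: False
    define b\<^sub>0 where "b\<^sub>0 = \<gamma> * t / (\<beta> + \<gamma>)"
    \<comment> \<open>The value 0 would force \<gamma> t = 0, and the value t would force \<beta> t
      = 0.\<close>
    have b0: "b\<^sub>0 \<in> UNIV - {0, t}"
      using \<beta> \<gamma> t False by (auto simp: b\<^sub>0_def field_simps)
    have "\<beta> * b\<^sub>0 = \<delta> * t" by (simp add: b\<^sub>0_def \<delta>_def)
    then have line: "line_ind \<beta> (b\<^sub>0, x) = line_ind \<delta> (t, x)" by (simp add: line_ind_def)
    have "conv (line_ind \<gamma>) (line_ind \<beta>) (t, x) =
        (\<Sum>b\<in>UNIV - {0, t}. if b = b\<^sub>0 then CARD('f) * line_ind \<beta> (b, x) else 1)"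
      using \<beta> \<gamma> by (simp add: conv_line_ind eq b\<^sub>0_def)
    also have "\<dots> = (\<Sum>b\<in>UNIV - {0, t}. 1 + (if b = b\<^sub>0 then CARD('f) * line_ind \<beta> (b, x) - 1 else 0))"
      by (rule sum.cong) auto
    also have "\<dots> = real (CARD('k) - 2) + (CARD('f) * line_ind \<beta> (b\<^sub>0, x) - 1)"
      using b0 t by (simp add: sum.distrib card_Diff_subset)
    finally show ?thesis using t by (simp add: line)
  qed
  then have "conv (line_ind \<gamma>) (line_ind \<beta>) =
      (\<lambda>x. if fst x = 0 then CARD('k) - 1 else (real (CARD('k) - 2) - 1) + CARD('f) * line_ind \<delta> x)"
    by auto
  moreover have "class_fun \<dots>"
    by (intro class_fun_if class_fun_const class_fun_add class_fun_mult class_fun_line_ind \<delta>)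
  ultimately show ?thesis by (simp only:)
qed

text \<open>Commutativity moves any of the first five classes to the right. For two classes
  \<open>Ix5\<close>, writing each as a line indicator minus \<open>Ix3\<close> leaves one product
  of line indicators and products with \<open>Ix3\<close>.\<close>

lemma class_fun_conv_ind_ind:
  assumes "i \<in> scheme_indices" "j \<in> scheme_indices"
  shows "class_fun (conv (ind cl i) (ind cl j))"
proof -
  consider "j \<in> {Ix0, Ix1, Ix2, Ix3, Ix4}" | "i \<in> {Ix0, Ix1, Ix2, Ix3, Ix4}"
    | \<beta> \<gamma> where "i = Ix5 \<beta>" "j = Ix5 \<gamma>" "\<beta> \<noteq> 0" "\<gamma> \<noteq> 0"
    using assms unfolding scheme_indices_def by blast
  then show ?thesis
  proof cases
    case 1
    then show ?thesis by (simp add: class_fun_conv_ind class_fun_ind)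
  next
    case 2
    then show ?thesis by (simp add: conv_commute[of "ind cl i"] class_fun_conv_ind class_fun_ind)
  next
    case 3
    have ind5: "ind cl (Ix5 \<epsilon>) = (\<lambda>x. line_ind \<epsilon> x - ind cl Ix3 x)" if "\<epsilon> \<noteq> 0" for \<epsilon>
      using that by (simp add: line_ind_eq)
    have "conv (ind cl i) (ind cl j) =
        (\<lambda>x. conv (line_ind \<beta>) (line_ind \<gamma>) x - conv (line_ind \<gamma>) (ind cl Ix3) x
          - conv (ind cl i) (ind cl Ix3) x)"
      using 3 by (simp add: ind5 conv_diff_left conv_diff_right conv_commute[of "line_ind \<gamma>" "ind cl Ix3"] algebra_simps)
    moreover have "class_fun \<dots>"
      using 3 by (intro class_fun_diff class_fun_conv_line_ind class_fun_conv_ind class_fun_line_ind class_fun_ind) auto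
    ultimately show ?thesis by (simp only:)
  qed
qed

end

section \<open>The number of classes and the conclusion\<close>

lemma card_scheme_indices: "card (scheme_indices :: 'k :: {finite, zero} scheme_index set) = CARD('k) + 4"
proof -
  have "{\<beta> :: 'k. \<beta> \<noteq> 0} = UNIV - {0}" by auto
  then have "card (Ix5 ` {\<beta> :: 'k. \<beta> \<noteq> 0}) = CARD('k) - 1"
    by (simp add: card_image inj_on_def card_Diff_subset)
  moreover have "card ({Ix0, Ix1, Ix2, Ix3, Ix4} \<union> Ix5 ` {\<beta> :: 'k. \<beta> \<noteq> 0}) =
      5 + card (Ix5 ` {\<beta> :: 'k. \<beta> \<noteq> 0})"
    by (subst card_Un_disjoint) auto
  moreover have "CARD('k) > 0" by simp
  ultimately show ?thesis unfolding scheme_indices_def by linarith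
qed

theorem theorem4p4:
  fixes q :: nat
    and \<phi> :: "'k :: {finite, field} \<Rightarrow> ('f :: {finite, field}) option"
  assumes "primepow q" and "primepow (q + 1)"
    and "CARD('k) = q + 1" and "CARD('f) = q"
    and "bij \<phi>" and "\<phi> 0 = None"
  shows "translation_association_scheme (q + 4) scheme_indices Ix0 (adjacency \<phi>)"
proof -
  interpret slope_labelling \<phi> by unfold_locales fact+
  show ?thesis
  \<comment> \<open>By \<open>cl_uminus\<close>, \<sigma> fixes the first five indices and sends
    \<open>Ix5 \<beta>\<close> to \<open>Ix5 (- \<beta>)\<close>.\<close>
  proof (rule translation_association_schemeI[where cl = cl])
    show "card (scheme_indices :: 'k scheme_index set) = q + 4 + 1"
      using assms(3) by (simp add: card_scheme_indices)
    show "conv (ind cl i) (ind cl j) x = conv (ind cl i) (ind cl j) y"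
      if "i \<in> scheme_indices" "j \<in> scheme_indices" "cl x = cl y" for i j x y
      using class_fun_conv_ind_ind[OF that(1,2)] that(3) unfolding class_fun_def by metis
  qed (simp_all add: adjacency_entry range_cl cl_eq_Ix0_iff cl_uminus)
qed

end
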